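(* Let $\mathcal{G}=(V,\mathcal{E})$ be a connected graph with countable vertex set, endowed with a weight function $a$ that makes it a transient weighted graph. Let $u\ge 0$, let $Q^u$ be the law on $\{0,1\}^V$ of the indicator function of the vacant set at level $u$ of random interlacements on $\mathcal{G}$, and let $f$ and $g$ be increasing random variables on $\{0,1\}^V$ with finite second moment with respect to $Q^u$. Then $$\int fg\,dQ^u\ \ge\ \int f\,dQ^u\int g\,dQ^u .$$
   Context: Weighted graphs. $\mathcal{G}=(V,\mathcal{E})$ is connected, $V$ is countable and $\mathcal{E}\subset\{\{x,y\}\subset V;\ x\neq y\}$; $x\leftrightarrow y$ means $\{x,y\}\in\mathcal{E}$. A weight function is a symmetric map $a:V\times V\to\mathbb{R}_+$ with $a_{x,y}>0$ iff $\{x,y\}\in\mathcal{E}$. Put $\mu_x=\sum_{y:\{x,y\}\in\mathcal{E}}a_{x,y}$, assumed finite. $P_x$ is the law of the random walk started at $x$ with transition probabilities $a_{x,y}/\mu_x$; the weighted graph is transient if this walk is transient. Capacity. For finite $K\subset V$, $\mathrm{cap}(K)=\inf\{\frac12\sum_{x,y\in V}|f(x)-f(y)|^2a_{x,y};\ f:V\to\mathbb{R}\text{ finitely supported},\ f\equiv1\text{ on }K\}$. With $\widetilde H_K=\inf\{n\ge1;X_n\in K\}$ and $e_K(x)=1_{\{x\in K\}}P_x[\widetilde H_K=\infty]\mu_x$, one has $\mathrm{cap}(K)=\sum_{x\in K}e_K(x)$. Random interlacements. $W_+$ (resp. $W$) is the set of nearest-neighbor trajectories indexed by $\mathbb{N}=\{0,1,\dots\}$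 (resp. $\mathbb{Z}$) that visit each vertex only finitely many times, with the $\sigma$-algebra generated by the canonical coordinates $X_n$. $W^*$ is the quotient of $W$ by time shift, with projection $\pi^*$ and the $\sigma$-algebra $\mathcal{W}^*=\{A;(\pi^* )^{-1}(A)\text{ measurable}\}$; $W_K$ is the set of $w\in W$ entering $K$, and $W_K^*=\pi^*(W_K)$. There is a unique $\sigma$-finite measure $\nu$ on $W^*$ such that for each finite $K\subset V$, $1_{W_K^*}\cdot\nu$ is the image under $\pi^*$ of the measure $Q_K$ on $W_K$ given by $Q_K[(X_{-n})_{n\ge0}\in A,X_0=x,(X_n)_{n\ge0}\in B]=P_x[A\mid\widetilde H_K=\infty]\,e_K(x)\,P_x[B]$ for measurable $A,B\subset W_+$ and $x\in V$. Let $\mathbb{P}$ be the law of a Poisson point process $\omega=\sum_i\delta_{(w_i^*,u_i)}$ on $W^*\times\mathbb{R}_+$ with intensity $\nu(dw^* )\otimes du$. The interlacement at level $u\ge0$ is $\mathcal{I}^u(\omega)=\bigcup_{i:u_i\le u}\mathrm{Range}(w_i^* )$, and the vacant set at level $u$ is $\mathcal{V}^u=V\setminus\mathcal{I}^u$. $Q^u$ is the law of $(1_{\{x\in\mathcal{V}^u\}})_{x\in V}$ on $\{0,1\}^V$ with the product $\sigma$-algebra generated by the canonical coordinates $(Y_x)_{x\in V}$. Equivalently, $Q^u$ is the unique probability measure on $\{0,1\}^V$ such that $$Q^u[Y_x=1\text{ for all }x\in K]=\exp(-u\cdot\mathrm{cap}(K))\quad\text{for all finite }K\subset V.$$ Monotonicity.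 For $\alpha,\alpha'\in\{0,1\}^V$ write $\alpha\succcurlyeq\alpha'$ if $\alpha(x)\ge\alpha'(x)$ for all $x\in V$. A real function $f$ on $\{0,1\}^V$ is increasing if $f(\alpha)\ge f(\alpha')$ whenever $\alpha\succcurlyeq\alpha'$. *)

theory Defs
  imports "HOL-Probability.Probability"
begin

section \<open>Weighted graphs\<close>

text \<open>The vertex set \<open>V\<close> is the universe of a countable type; an edge is a two-element set.\<close>

definition vertex_weight :: "'v set set \<Rightarrow> ('v \<Rightarrow> 'v \<Rightarrow> real) \<Rightarrow> 'v \<Rightarrow> real" where
  "vertex_weight E a x = (\<Sum>\<^sub>\<infinity>y\<in>{y. {x, y} \<in> E}. a x y)"

locale weighted_graph =
  fixes E :: "'v::countable set set" and a :: "'v \<Rightarrow> 'v \<Rightarrow> real"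
  assumes edges: "E \<subseteq> {{x, y} | x y. x \<noteq> y}"
    and connected: "(x, y) \<in> {(v, w). {v, w} \<in> E}\<^sup>*"
    and weight_sym: "a x y = a y x"
    and weight_nonneg: "0 \<le> a x y"
    and weight_pos_iff: "0 < a x y \<longleftrightarrow> {x, y} \<in> E"
    and weight_summable: "(\<lambda>y. a x y) summable_on {y. {x, y} \<in> E}"

section \<open>Random walk\<close>

text \<open>Vertex weights vanish only on the edgeless one-vertex graph. There the step distribution is
  unspecified, but there are no trajectories, so nothing below depends on it.\<close>

definition step_pmf :: "'v set set \<Rightarrow> ('v \<Rightarrow> 'v \<Rightarrow> real) \<Rightarrow> 'v \<Rightarrow> 'v pmf" where
  "step_pmf E a x = embed_pmf (\<lambda>y. a x y / vertex_weight E a x)"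

text \<open>The conditional law of the \<open>n\<close>-th position of the walk given the previous ones.\<close>

definition walk_kernel ::
    "'v set set \<Rightarrow> ('v \<Rightarrow> 'v \<Rightarrow> real) \<Rightarrow> 'v \<Rightarrow> nat \<Rightarrow> (nat \<Rightarrow> 'v) \<Rightarrow> 'v measure" where
  "walk_kernel E a x n w =
     (if n = 0 then return (count_space UNIV) x else measure_pmf (step_pmf E a (w (n - 1))))"

text \<open>The law \<open>P\<^sub>x\<close>, on all sequences of vertices, is the Ionescu-Tulcea limit of these kernels;
  see \<open>walk_law_cylinder\<close> below.\<close>

definition walk_law ::
    "'v set set \<Rightarrow> ('v \<Rightarrow> 'v \<Rightarrow> real) \<Rightarrow> 'v \<Rightarrow> (nat \<Rightarrow> 'v) measure" where
  "walk_law E a x =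
     projective_family.lim UNIV
       (Ionescu_Tulcea.CI (walk_kernel E a x) (\<lambda>_. count_space UNIV)) (\<lambda>_. count_space UNIV)"

lemma pmf_step_pmf:
  assumes "weighted_graph E a" and pos: "0 < vertex_weight E a x"
  shows "pmf (step_pmf E a x) y = a x y / vertex_weight E a x"
proof -
  interpret weighted_graph E a by fact
  have off: "a x y = 0" if "y \<notin> {y. {x, y} \<in> E}" for y
    using that weight_pos_iff[of x y] weight_nonneg[of x y] by simp
  have "(\<lambda>y. a x y) summable_on UNIV"
    using weight_summable[of x] by (rule summable_on_cong_neutral[THEN iffD1, rotated -1]) (use off in auto)
  then have "((\<lambda>y. a x y) has_sum (\<Sum>\<^sub>\<infinity>y. a x y)) UNIV"
    by simp
  also have "(\<Sum>\<^sub>\<infinity>y. a x y) = vertex_weight E a x"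
    unfolding vertex_weight_def by (rule infsum_cong_neutral) (use off in auto)
  finally have "((\<lambda>y. a x y / vertex_weight E a x) has_sum 1) UNIV"
    using has_sum_cmult_left[of "a x" UNIV "vertex_weight E a x" "inverse (vertex_weight E a x)"] pos
    by (simp add: field_simps)
  then have sum: "(\<lambda>y. norm (a x y / vertex_weight E a x)) summable_on UNIV"
      "(\<Sum>\<^sub>\<infinity>y. a x y / vertex_weight E a x) = 1"
    using pos weight_nonneg by (auto simp: summable_on_def infsumI abs_of_pos)
  note Infinite_Set_Sum.abs_summable_equivalent[THEN iffD1, OF sum(1)]
  with sum(2) have "(\<integral>\<^sup>+ y. ennreal (a x y / vertex_weight E a x) \<partial>count_space UNIV) = 1"
    using pos weight_nonneg by (simp add: nn_integral_conv_infsetsum infsetsum_infsum)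
  then show ?thesis
    unfolding step_pmf_def using pos weight_nonneg by (intro pmf_embed_pmf) auto
qed

lemma Ionescu_Tulcea_walk_kernel:
  fixes E :: "'v::countable set set"
  shows "Ionescu_Tulcea (walk_kernel E a x) (\<lambda>_. count_space UNIV)"
proof (rule Ionescu_Tulcea.intro)
  fix n
  show "walk_kernel E a x n \<in>
      measurable (PiM {0..<n} (\<lambda>_. count_space UNIV)) (subprob_algebra (count_space UNIV))"
  proof (cases n)
    case 0
    then show ?thesis
      by (simp add: walk_kernel_def[abs_def] space_subprob_algebra
          prob_space_imp_subprob_space prob_space_return)
  next
    case (Suc m)
    then have "(\<lambda>w. w m) \<in> measurable (PiM {0..<n} (\<lambda>_. count_space (UNIV::'v set)))
        (count_space UNIV)"
      by (intro measurable_component_singleton) auto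
    then have "(\<lambda>w. measure_pmf (step_pmf E a (w m))) \<in>
        measurable (PiM {0..<n} (\<lambda>_. count_space UNIV)) (subprob_algebra (count_space UNIV))"
      by (rule measurable_compose) (simp add: measure_pmf_in_subprob_algebra)
    then show ?thesis
      using Suc by (simp add: walk_kernel_def[abs_def])
  qed
next
  fix n :: nat and w :: "nat \<Rightarrow> 'v"
  show "prob_space (walk_kernel E a x n w)"
    by (auto simp: walk_kernel_def prob_space_return measure_pmf.prob_space_axioms)
qed

lemma walk_law_cylinder:
  fixes E :: "'v::countable set set"
  assumes G: "weighted_graph E a" and pos: "\<And>y. 0 < vertex_weight E a y"
  shows "\<P>(w in walk_law E a x. \<forall>i\<le>n. w i = p i) =
    of_bool (p 0 = x) * (\<Prod>i<n. a (p i) (p (Suc i)) / vertex_weight E a (p i))"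
proof -
  let ?M = "\<lambda>_::nat. count_space (UNIV::'v set)"
  interpret IT: Ionescu_Tulcea "walk_kernel E a x" ?M
    by (rule Ionescu_Tulcea_walk_kernel)
  define X where "X n = {w \<in> space (PiM {0..<Suc n} ?M). \<forall>i\<le>n. w i = p i}" for n
  have X: "X n \<in> sets (PiM {0..<Suc n} ?M)" for n
  proof -
    have "X n = PiE {0..<Suc n} (\<lambda>i. {p i})"
      by (auto simp: X_def space_PiM PiE_iff extensional_def less_Suc_eq_le)
    then show ?thesis by (simp add: sets_PiM_I_finite)
  qed
  let ?c = "\<lambda>n. of_bool (p 0 = x) * (\<Prod>i<n. a (p i) (p (Suc i)) / vertex_weight E a (p i))"
  have nonneg: "0 \<le> ?c n" for n
    using weighted_graph.weight_nonneg[OF G] pos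
    by (auto intro!: mult_nonneg_nonneg prod_nonneg divide_nonneg_pos)
  have upd0: "(\<lambda>y. (\<lambda>_. undefined)(0 := y)) -` X 0 = {p 0}"
    by (auto simp: X_def space_PiM PiE_iff extensional_def)
  have upd: "fun_upd w (Suc n) -` X (Suc n) = (if w \<in> X n then {p (Suc n)} else {})"
    if "w \<in> space (PiM {0..<Suc n} ?M)" for w n
    using that by (auto simp: X_def space_PiM PiE_iff extensional_def le_Suc_eq)
  have C: "emeasure (IT.C 0 (Suc n) (\<lambda>_. undefined)) (X n) = ennreal (?c n)" for n
  proof (induction n)
    case 0
    have "emeasure (IT.C 0 (Suc 0) (\<lambda>_. undefined)) (X 0) = emeasure (IT.eP 0 (\<lambda>_. undefined)) (X 0)"
      using bind_return[OF IT.measurable_eP[of 0], of "\<lambda>_. undefined"] by (simp add: space_PiM)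
    also have "\<dots> = emeasure (walk_kernel E a x 0 (\<lambda>_. undefined)) {p 0}"
      using X[of 0] upd0 by (subst IT.emeasure_eP) (auto simp: space_PiM)
    also have "\<dots> = ennreal (?c 0)"
      by (simp add: walk_kernel_def indicator_def)
    finally show ?case .
  next
    case (Suc n)
    let ?q = "a (p n) (p (Suc n)) / vertex_weight E a (p n)"
    have u: "(\<lambda>_. undefined) \<in> space (PiM {0..<0} ?M)"
      by (simp add: space_PiM)
    have sp: "space (IT.C 0 (Suc n) (\<lambda>_. undefined)) = space (PiM {0..<Suc n} ?M)"
      using IT.space_C[OF u, of "Suc n"] by simp
    have se: "sets (IT.C 0 (Suc n) (\<lambda>_. undefined)) = sets (PiM {0..<Suc n} ?M)"
      using IT.sets_C[OF u, of "Suc n"] by simp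
    have ne: "space (IT.C 0 (Suc n) (\<lambda>_. undefined)) \<noteq> {}"
      using prob_space.not_empty[OF IT.prob_space_C[OF u]] .
    have "emeasure (IT.C 0 (Suc (Suc n)) (\<lambda>_. undefined)) (X (Suc n)) =
        (\<integral>\<^sup>+w. emeasure (IT.eP (Suc n) w) (X (Suc n)) \<partial>IT.C 0 (Suc n) (\<lambda>_. undefined))"
      unfolding IT.C.simps(2)[of 0 "Suc n"] add_0
      using IT.measurable_eP[of "Suc n"]
      by (intro emeasure_bind[OF ne _ X]) (simp add: measurable_cong_sets[OF se refl] del: IT.C.simps)
    also have "\<dots> = (\<integral>\<^sup>+w. ennreal ?q * indicator (X n) w \<partial>IT.C 0 (Suc n) (\<lambda>_. undefined))"
    proof (rule nn_integral_cong)
      fix w assume "w \<in> space (IT.C 0 (Suc n) (\<lambda>_. undefined))"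
      then have w: "w \<in> space (PiM {0..<Suc n} ?M)"
        unfolding sp .
      have "emeasure (IT.eP (Suc n) w) (X (Suc n)) =
          emeasure (measure_pmf (step_pmf E a (w n))) (if w \<in> X n then {p (Suc n)} else {})"
        using upd[OF w] by (subst IT.emeasure_eP[OF w X]) (simp add: walk_kernel_def)
      also have "\<dots> = ennreal ?q * indicator (X n) w"
        using pmf_step_pmf[OF G pos] by (auto simp: emeasure_pmf_single X_def)
      finally show "emeasure (IT.eP (Suc n) w) (X (Suc n)) = ennreal ?q * indicator (X n) w" .
    qed
    also have "\<dots> = ennreal ?q * ennreal (?c n)"
      using X[of n] Suc by (subst nn_integral_cmult_indicator) (auto simp: se simp del: IT.C.simps)
    also have "\<dots> = ennreal (?q * ?c n)"
      using weighted_graph.weight_nonneg[OF G] pos nonneg[of n]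
      by (intro ennreal_mult[symmetric]) (auto intro!: divide_nonneg_pos)
    also have "?q * ?c n = ?c (Suc n)"
      by simp
    finally show ?case .
  qed
  have emb: "prod_emb UNIV ?M {0..<Suc n} (X n) = {w \<in> space (walk_law E a x). \<forall>i\<le>n. w i = p i}"
    by (auto simp: prod_emb_def X_def space_PiM walk_law_def restrict_def)
  have "emeasure (walk_law E a x) (prod_emb UNIV ?M {0..<Suc n} (X n)) =
      emeasure (IT.CI {0..<Suc n}) (X n)"
    unfolding walk_law_def using X by (intro IT.lim) auto
  also have "\<dots> = emeasure (IT.C 0 (Suc n) (\<lambda>_. undefined)) (X n)"
    using X[of n] sets.sets_into_space[OF X[of n]]
    by (subst IT.emeasure_CI[of _ "Suc n"]) (auto simp: prod_emb_id space_PiM simp del: IT.C.simps)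
  finally show ?thesis
    unfolding emb C using nonneg[of n] by (simp add: measure_def)
qed

locale transient_weighted_graph = weighted_graph +
  assumes transient: "\<P>(w in walk_law E a x. \<exists>n\<ge>1. w n = x) < 1"

definition equilibrium ::
    "'v set set \<Rightarrow> ('v \<Rightarrow> 'v \<Rightarrow> real) \<Rightarrow> 'v set \<Rightarrow> 'v \<Rightarrow> real" where
  "equilibrium E a K x =
     indicator K x * \<P>(w in walk_law E a x. \<forall>n\<ge>1. w n \<notin> K) * vertex_weight E a x"

section \<open>Trajectories\<close>

definition forward_trajectories :: "'v set set \<Rightarrow> (nat \<Rightarrow> 'v) set" where
  "forward_trajectories E =
     {w. (\<forall>n. {w n, w (n + 1)} \<in> E) \<and> (\<forall>x. finite {n. w n = x})}"

definition trajectories :: "'v set set \<Rightarrow> (int \<Rightarrow> 'v) set" where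
  "trajectories E =
     {w. (\<forall>n. {w n, w (n + 1)} \<in> E) \<and> (\<forall>x. finite {n. w n = x})}"

definition forward_space :: "'v set set \<Rightarrow> (nat \<Rightarrow> 'v) measure" where
  "forward_space E = restrict_space (\<Pi>\<^sub>M n\<in>UNIV. count_space UNIV) (forward_trajectories E)"

definition trajectory_space :: "'v set set \<Rightarrow> (int \<Rightarrow> 'v) measure" where
  "trajectory_space E = restrict_space (\<Pi>\<^sub>M n\<in>UNIV. count_space UNIV) (trajectories E)"

definition shift_rel :: "'v set set \<Rightarrow> ((int \<Rightarrow> 'v) \<times> (int \<Rightarrow> 'v)) set" where
  "shift_rel E = {(w, w'). w \<in> trajectories E \<and> w' \<in> trajectories E \<and>
     (\<exists>k. \<forall>n. w' n = w (n + k))}"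

definition shift_class :: "'v set set \<Rightarrow> (int \<Rightarrow> 'v) \<Rightarrow> (int \<Rightarrow> 'v) set" where
  "shift_class E w = shift_rel E `` {w}"

definition class_space :: "'v set set \<Rightarrow> (int \<Rightarrow> 'v) set measure" where
  "class_space E = sigma (trajectories E // shift_rel E)
     {A. A \<subseteq> trajectories E // shift_rel E \<and>
         {w \<in> trajectories E. shift_class E w \<in> A} \<in> sets (trajectory_space E)}"

definition trajectories_entering :: "'v set set \<Rightarrow> 'v set \<Rightarrow> (int \<Rightarrow> 'v) set" where
  "trajectories_entering E K = {w \<in> trajectories E. \<exists>n. w n \<in> K}"

definition classes_entering :: "'v set set \<Rightarrow> 'v set \<Rightarrow> (int \<Rightarrow> 'v) set set" where
  "classes_entering E K = shift_class E ` trajectories_entering E K"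

definition class_range :: "(int \<Rightarrow> 'v) set \<Rightarrow> 'v set" where
  "class_range c = (\<Union>w\<in>c. range w)"

section \<open>The intensity measure\<close>

text \<open>\<open>Q\<^sub>K\<close> is viewed as a measure on all of \<open>W\<close>: the formula makes it vanish on \<open>X\<^sub>0 \<notin> K\<close>, hence
  off \<open>W\<^sub>K\<close>.\<close>

definition is_Q_measure ::
    "'v set set \<Rightarrow> ('v \<Rightarrow> 'v \<Rightarrow> real) \<Rightarrow> 'v set \<Rightarrow> (int \<Rightarrow> 'v) measure \<Rightarrow> bool" where
  "is_Q_measure E a K Q \<longleftrightarrow>
     sets Q = sets (trajectory_space E) \<and>
     (\<forall>x. \<forall>A\<in>sets (forward_space E). \<forall>B\<in>sets (forward_space E).
        emeasure Q {w \<in> trajectories E.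
            (\<lambda>n. w (- int n)) \<in> A \<and> w 0 = x \<and> (\<lambda>n. w (int n)) \<in> B} =
        ennreal (\<P>(w in walk_law E a x. w \<in> A \<bar> (\<forall>n\<ge>1. w n \<notin> K)) * equilibrium E a K x *
                 \<P>(w in walk_law E a x. w \<in> B)))"

definition is_interlacement_intensity ::
    "'v set set \<Rightarrow> ('v \<Rightarrow> 'v \<Rightarrow> real) \<Rightarrow> (int \<Rightarrow> 'v) set measure \<Rightarrow> bool" where
  "is_interlacement_intensity E a \<nu> \<longleftrightarrow>
     sigma_finite_measure \<nu> \<and> sets \<nu> = sets (class_space E) \<and>
     (\<forall>K. finite K \<longrightarrow>
        (\<exists>Q. is_Q_measure E a K Q \<and>
             density \<nu> (indicator (classes_entering E K)) = distr Q (class_space E) (shift_class E)))"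

section \<open>Poisson point processes\<close>

text \<open>A countable sum of Dirac masses is represented by its multiplicity function.\<close>

definition point_configs :: "'p measure \<Rightarrow> ('p \<Rightarrow> nat) set" where
  "point_configs N = {\<omega>. {p. \<omega> p \<noteq> 0} \<subseteq> space N \<and> countable {p. \<omega> p \<noteq> 0}}"

definition num_points :: "('p \<Rightarrow> nat) \<Rightarrow> 'p set \<Rightarrow> ennreal" where
  "num_points \<omega> D = emeasure (point_measure UNIV (\<lambda>p. of_nat (\<omega> p))) D"

definition config_space :: "'p measure \<Rightarrow> ('p \<Rightarrow> nat) measure" where
  "config_space N = sigma (point_configs N)
     {{\<omega> \<in> point_configs N. num_points \<omega> D \<in> B} | D B. D \<in> sets N \<and> B \<in> sets borel}"

definition is_poisson_law :: "'p measure \<Rightarrow> ('p \<Rightarrow> nat) measure \<Rightarrow> bool" where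
  "is_poisson_law N P \<longleftrightarrow>
     prob_space P \<and> sets P = sets (config_space N) \<and>
     (\<forall>D\<in>sets N. emeasure N D < \<infinity> \<longrightarrow>
        (\<forall>k. \<P>(\<omega> in P. num_points \<omega> D = of_nat k) =
             measure N D ^ k / fact k * exp (- measure N D))) \<and>
     (\<forall>(n::nat) D. D ` {..<n} \<subseteq> sets N \<and> disjoint_family_on D {..<n} \<longrightarrow>
        prob_space.indep_vars P (\<lambda>_. borel) (\<lambda>i \<omega>. num_points \<omega> (D i)) {..<n})"

section \<open>Random interlacements\<close>

definition is_interlacement_law ::
    "'v set set \<Rightarrow> ('v \<Rightarrow> 'v \<Rightarrow> real) \<Rightarrow> ((int \<Rightarrow> 'v) set \<times> real \<Rightarrow> nat) measure \<Rightarrow> bool" where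
  "is_interlacement_law E a P \<longleftrightarrow>
     (\<exists>\<nu>. is_interlacement_intensity E a \<nu> \<and>
          is_poisson_law (\<nu> \<Otimes>\<^sub>M restrict_space lborel {0..}) P)"

definition interlacement :: "real \<Rightarrow> ((int \<Rightarrow> 'v) set \<times> real \<Rightarrow> nat) \<Rightarrow> 'v set" where
  "interlacement u \<omega> = (\<Union>{class_range c | c t. \<omega> (c, t) \<noteq> 0 \<and> t \<le> u})"

definition vacant_set :: "real \<Rightarrow> ((int \<Rightarrow> 'v) set \<times> real \<Rightarrow> nat) \<Rightarrow> 'v set" where
  "vacant_set u \<omega> = UNIV - interlacement u \<omega>"

text \<open>The law \<open>Q\<^sup>u\<close>. The space \<open>{0,1}\<^sup>V\<close> is \<open>'v \<Rightarrow> bool\<close>, whose library order is the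
  pointwise one, so that increasing functions are those satisfying \<^const>\<open>mono\<close>.\<close>

definition vacant_law ::
    "((int \<Rightarrow> 'v) set \<times> real \<Rightarrow> nat) measure \<Rightarrow> real \<Rightarrow> ('v \<Rightarrow> bool) measure" where
  "vacant_law P u = distr P (\<Pi>\<^sub>M x\<in>UNIV. count_space UNIV) (\<lambda>\<omega> x. x \<in> vacant_set u \<omega>)"

end

theory Submission
  imports Defs
begin

text \<open>
  Fix a finite set \<open>K\<close> of vertices and sort the trajectories with label at most \<open>u\<close> by the trace
  \<open>S \<subseteq> K\<close> that their range leaves on \<open>K\<close>. Different traces give disjoint regions of the space of
  labelled trajectories, so the events ``no point of the process has trace \<open>S\<close>'' are independent.
  A vertex \<open>x \<in> K\<close> is vacant iff this event occurs for every \<open>S\<close> containing \<open>x\<close>; hence the vacant set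
  inside \<open>K\<close> is an increasing function of finitely many independent bits. Harris' inequality then
  shows that increasing events depending on \<open>K\<close> are positively correlated
  (\<open>vacant_cylinder_correlated\<close>).

  The passage to infinitely many coordinates cannot simply condition on the configuration in \<open>K\<close>:
  the conditional expectation of an increasing function need not be increasing when correlations
  alone are known to be positive. Compactness is used instead. By inner regularity a measurable
  increasing event contains a compact set of almost the same probability; the upward closure of a
  compact set is still contained in the event and is a decreasing intersection of increasing
  cylinder events, to which the finite case applies (\<open>positively_correlated_up_sets\<close>).

  Finally a square-integrable increasing function is a dominated limit of functions that are,
  up to a constant, positive combinations of indicators of its upper level sets. Since covariance is
  bilinear and vanishes on constants, positive correlation of these sets suffices
  (\<open>covariance_nonneg_if_level_sets_correlated\<close>).
\<close>

section \<open>Harris' inequality for independent bits\<close>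

text \<open>Harris' inequality for a single bit: the covariance is a product of two nonnegative increments
  times the variance \<open>p * q\<close> of the bit.\<close>

lemma Chebyshev_two_points:
  fixes p q :: real
  assumes "p + q = 1" "0 \<le> p" "0 \<le> q" "a' \<le> a" "b' \<le> b"
  shows "(p * a + q * a') * (p * b + q * b') \<le> p * (a * b) + q * (a' * b')"
proof -
  have q: "q = 1 - p"
    using assms by simp
  have "p * (a * b) + q * (a' * b') - (p * a + q * a') * (p * b + q * b') = p * q * ((a - a') * (b - b'))"
    unfolding q by algebra
  moreover have "0 \<le> p * q * ((a - a') * (b - b'))"
    using assms by (intro mult_nonneg_nonneg) auto
  ultimately show ?thesis by linarith
qed

lemma finite_set_Pi_pmf_bool:
  assumes "finite I"
  shows "finite (set_pmf (Pi_pmf I False (p :: 'i \<Rightarrow> bool pmf)))"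
  using assms by (intro finite_subset[OF set_Pi_pmf_subset'] finite_PiE_dflt) auto

lemma expectation_Pi_pmf_insert_bool:
  fixes h :: "('i \<Rightarrow> bool) \<Rightarrow> real"
  assumes "finite I" "i \<notin> I"
  shows "measure_pmf.expectation (Pi_pmf (insert i I) False p) h =
    pmf (p i) True * measure_pmf.expectation (Pi_pmf I False p) (\<lambda>z. h (z(i := True))) +
    pmf (p i) False * measure_pmf.expectation (Pi_pmf I False p) (\<lambda>z. h (z(i := False)))"
proof -
  have "Pi_pmf (insert i I) False p = p i \<bind> (\<lambda>y. map_pmf (\<lambda>z. z(i := y)) (Pi_pmf I False p))"
    using assms by (simp add: Pi_pmf_insert' map_pmf_def)
  then show ?thesis
    using finite_set_Pi_pmf_bool[OF assms(1)]
    by (simp add: pmf_expectation_bind[of UNIV]) (simp add: UNIV_bool)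
qed

text \<open>Induction on the bits. Given the value of the new bit, the induction hypothesis applies to the
  remaining ones; the two resulting conditional means are increasing in the new bit, and the
  single-bit case handles their product.\<close>

lemma Harris_Pi_pmf:
  fixes f g :: "('i \<Rightarrow> bool) \<Rightarrow> real"
  assumes "finite I" "mono f" "mono g"
  shows "measure_pmf.expectation (Pi_pmf I False p) f * measure_pmf.expectation (Pi_pmf I False p) g
    \<le> measure_pmf.expectation (Pi_pmf I False p) (\<lambda>z. f z * g z)"
  using assms
proof (induction I arbitrary: f g rule: finite_induct)
  case empty
  then show ?case by (simp)
next
  case (insert i I)
  let ?E = "measure_pmf.expectation (Pi_pmf I False p)"
  have upd: "mono (\<lambda>z. h (z(i := y)))" if "mono h" for h :: "('i \<Rightarrow> bool) \<Rightarrow> real" and y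
    using that by (intro monoI, elim monoD) (auto simp: le_fun_def)
  have int: "integrable (Pi_pmf I False p) h" for h :: "('i \<Rightarrow> bool) \<Rightarrow> real"
    using finite_set_Pi_pmf_bool[OF insert.hyps(1)] by (rule integrable_measure_pmf_finite)
  have le: "?E (\<lambda>z. h (z(i := False))) \<le> ?E (\<lambda>z. h (z(i := True)))"
    if "mono h" for h :: "('i \<Rightarrow> bool) \<Rightarrow> real"
    using that by (intro integral_mono int, elim monoD) (auto simp: le_fun_def)
  have IH: "?E (\<lambda>z. f (z(i := y))) * ?E (\<lambda>z. g (z(i := y)))
      \<le> ?E (\<lambda>z. f (z(i := y)) * g (z(i := y)))" for y
    by (intro insert.IH upd insert.prems)
  have sum1: "pmf (p i) True + pmf (p i) False = 1"
    using sum_pmf_eq_1[OF finite subset_UNIV, of "p i"] by (simp add: UNIV_bool)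
  show ?case
    unfolding expectation_Pi_pmf_insert_bool[OF insert.hyps]
    by (rule order_trans[OF Chebyshev_two_points[OF sum1 _ _ le le]])
      (intro insert.prems add_mono mult_left_mono IH pmf_nonneg)+
qed

text \<open>Brings independent Boolean random variables on any probability space into the scope of
  \<open>Harris_Pi_pmf\<close>: the joint law of finitely many of them is a product of Bernoulli laws. Outside \<open>I\<close> the bits are set to the default
  value of the product.\<close>

lemma (in prob_space) expectation_indep_bits:
  fixes h :: "('i \<Rightarrow> bool) \<Rightarrow> real"
  assumes I: "finite I" and Z: "indep_vars (\<lambda>_. count_space UNIV) Z I"
  shows "expectation (\<lambda>\<omega>. h (\<lambda>i. i \<in> I \<and> Z i \<omega>)) =
    measure_pmf.expectation (Pi_pmf I False (\<lambda>i. bernoulli_pmf (prob {\<omega> \<in> space M. Z i \<omega>}))) h"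
proof -
  let ?p = "\<lambda>i. bernoulli_pmf (prob {\<omega> \<in> space M. Z i \<omega>})"
  let ?S = "PiE_dflt I False (\<lambda>_. UNIV :: bool set)"
  let ?W = "\<lambda>\<omega> i. i \<in> I \<and> Z i \<omega>"
  have S: "finite ?S"
    using I by auto
  have rv: "Z i \<in> measurable M (count_space UNIV)" if "i \<in> I" for i
    using Z that by (auto simp: indep_vars_def)
  have ev [measurable]: "{\<omega> \<in> space M. ?W \<omega> = z} \<in> events" for z
  proof -
    have "{\<omega> \<in> space M. ?W \<omega> = z} =
        {\<omega> \<in> space M. (\<forall>i\<in>I. Z i \<omega> = z i) \<and> (\<forall>i. i \<notin> I \<longrightarrow> \<not> z i)}"
      by (auto simp: fun_eq_iff)
    also have "\<dots> \<in> events"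
      using I rv by measurable
    finally show ?thesis .
  qed
  have law: "prob {\<omega> \<in> space M. ?W \<omega> = z} = pmf (Pi_pmf I False ?p) z" if z: "z \<in> ?S" for z
  proof -
    have factor: "prob (Z i -` {z i} \<inter> space M) = pmf (?p i) (z i)" if i: "i \<in> I" for i
    proof (cases "z i")
      case True
      have "Z i -` {True} \<inter> space M = {\<omega> \<in> space M. Z i \<omega>}" by auto
      then show ?thesis using True by simp
    next
      case False
      have "{\<omega> \<in> space M. Z i \<omega>} \<in> events"
        using rv[OF i] by measurable
      moreover have "Z i -` {False} \<inter> space M = space M - {\<omega> \<in> space M. Z i \<omega>}" by auto
      ultimately show ?thesis using False by (simp add: prob_compl)
    qed
    have "prob {\<omega> \<in> space M. ?W \<omega> = z} = (\<Prod>i\<in>I. prob (Z i -` {z i} \<inter> space M))"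
    proof (cases "I = {}")
      case True
      then have "{\<omega> \<in> space M. ?W \<omega> = z} = space M"
        using z by (auto simp: PiE_dflt_def)
      then show ?thesis using True by (simp add: prob_space)
    next
      case False
      have "{\<omega> \<in> space M. ?W \<omega> = z} = (\<Inter>i\<in>I. Z i -` {z i} \<inter> space M)"
        using z False by (auto simp: PiE_dflt_def fun_eq_iff)
      then show ?thesis
        using indep_varsD_finite[OF Z False I, of "\<lambda>i. {z i}"] by simp
    qed
    also have "\<dots> = pmf (Pi_pmf I False ?p) z"
      using z I factor by (simp add: pmf_Pi PiE_dflt_def)
    finally show ?thesis .
  qed
  have "expectation (\<lambda>\<omega>. h (?W \<omega>)) =
      expectation (\<lambda>\<omega>. \<Sum>z\<in>?S. h z * indicator {\<omega> \<in> space M. ?W \<omega> = z} \<omega>)"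
  proof (rule Bochner_Integration.integral_cong[OF refl])
    fix \<omega> assume "\<omega> \<in> space M"
    then have "(\<Sum>z\<in>?S. h z * indicator {\<omega> \<in> space M. ?W \<omega> = z} \<omega>) =
        (\<Sum>z\<in>?S. if z = ?W \<omega> then h z else 0)"
      by (intro sum.cong) auto
    also have "\<dots> = h (?W \<omega>)"
      using S by (subst sum.delta) (auto simp: PiE_dflt_def)
    finally show "h (?W \<omega>) = (\<Sum>z\<in>?S. h z * indicator {\<omega> \<in> space M. ?W \<omega> = z} \<omega>)" ..
  qed
  also have "\<dots> = (\<Sum>z\<in>?S. h z * prob {\<omega> \<in> space M. ?W \<omega> = z})"
    by (subst Bochner_Integration.integral_sum) (auto simp: Int_absorb1 emeasure_eq_measure)
  also have "\<dots> = (\<Sum>z\<in>?S. h z * pmf (Pi_pmf I False ?p) z)"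
    using law by (intro sum.cong) auto
  also have "\<dots> = measure_pmf.expectation (Pi_pmf I False ?p) h"
    using S set_Pi_pmf_subset[OF I, of False ?p]
    by (intro integral_measure_pmf_real[symmetric]) (auto simp: PiE_dflt_def)
  finally show ?thesis .
qed

lemma (in prob_space) Harris_indep_bits:
  fixes f g :: "('i \<Rightarrow> bool) \<Rightarrow> real"
  assumes "finite I" "indep_vars (\<lambda>_. count_space UNIV) Z I" "mono f" "mono g"
  shows "expectation (\<lambda>\<omega>. f (\<lambda>i. i \<in> I \<and> Z i \<omega>)) * expectation (\<lambda>\<omega>. g (\<lambda>i. i \<in> I \<and> Z i \<omega>))
    \<le> expectation (\<lambda>\<omega>. f (\<lambda>i. i \<in> I \<and> Z i \<omega>) * g (\<lambda>i. i \<in> I \<and> Z i \<omega>))"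
  unfolding expectation_indep_bits[OF assms(1,2), of f] expectation_indep_bits[OF assms(1,2), of g]
    expectation_indep_bits[OF assms(1,2), of "\<lambda>z. f z * g z"]
  by (rule Harris_Pi_pmf[OF assms(1,3,4)])

section \<open>From cylinder up-sets to measurable up-sets\<close>

abbreviation bits :: "('v \<Rightarrow> bool) measure" where
  "bits \<equiv> \<Pi>\<^sub>M x\<in>UNIV. count_space UNIV"

text \<open>The increasing cylinder event generated by \<open>C\<close>, seen through the coordinates in \<open>K\<close> alone.\<close>

definition up_closure_on :: "'v set \<Rightarrow> ('v \<Rightarrow> bool) set \<Rightarrow> ('v \<Rightarrow> bool) set" where
  "up_closure_on K C = {\<alpha>. \<exists>\<beta>\<in>C. \<forall>x\<in>K. \<beta> x \<le> \<alpha> x}"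

lemma space_bits: "space bits = UNIV"
  by (simp add: space_PiM)

lemma measurable_bit: "(\<lambda>\<alpha>. \<alpha> x) \<in> measurable bits (count_space UNIV)"
  by (rule measurable_component_singleton) simp

lemma up_closure_on_measurable:
  assumes "finite K"
  shows "up_closure_on K C \<in> sets bits"
proof -
  let ?T = "(\<lambda>\<beta>. {x \<in> K. \<beta> x}) ` C"
  have "up_closure_on K C = (\<Union>T\<in>?T. {\<alpha> \<in> space bits. \<forall>x\<in>T. \<alpha> x})"
    by (auto simp: up_closure_on_def space_bits le_bool_def)
  also have "\<dots> \<in> sets bits"
  proof (rule sets.finite_UN)
    show "finite ?T"
      using assms by (intro finite_subset[of ?T "Pow K"]) auto
    fix T assume "T \<in> ?T"
    then have "finite T" using assms by auto
    then show "{\<alpha> \<in> space bits. \<forall>x\<in>T. \<alpha> x} \<in> sets bits"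
      using measurable_bit by measurable
  qed
  finally show ?thesis .
qed

lemma up_closure_on_antimono: "K \<subseteq> K' \<Longrightarrow> up_closure_on K' C \<subseteq> up_closure_on K C"
  by (auto simp: up_closure_on_def)

text \<open>Inner regularity is available for Borel measures on complete separable metric spaces, and the real
  sequence space over a countable index set is one. Configurations are therefore embedded into it as
  \<open>0\<close>-\<open>1\<close>-valued functions; compactness of the approximating set is stated on the real side.\<close>

lemma inner_regular_bits:
  fixes M :: "('v::countable \<Rightarrow> bool) measure"
  assumes "finite_measure M" and sets_M: "sets M = sets bits" and A: "A \<in> sets M" and e: "0 < e"
  obtains D where "compact D" "(\<lambda>\<alpha> x. of_bool (\<alpha> x) :: real) -` D \<in> sets M"
    "(\<lambda>\<alpha> x. of_bool (\<alpha> x)) -` D \<subseteq> A" "D \<subseteq> range (\<lambda>\<alpha> x. of_bool (\<alpha> x))"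
    "measure M A - e \<le> measure M ((\<lambda>\<alpha> x. of_bool (\<alpha> x)) -` D)"
proof -
  interpret finite_measure M by fact
  define \<iota> :: "('v \<Rightarrow> bool) \<Rightarrow> 'v \<Rightarrow> real" where "\<iota> = (\<lambda>\<alpha> x. of_bool (\<alpha> x))"
  \<comment> \<open>A measurable left inverse of the embedding, used to see that the embedded event is Borel.\<close>
  define \<rho> :: "('v \<Rightarrow> real) \<Rightarrow> 'v \<Rightarrow> bool" where "\<rho> = (\<lambda>\<beta> x. \<beta> x = 1)"
  have space_M: "space M = UNIV"
    using sets_eq_imp_space_eq[OF sets_M] by (simp add: space_bits)
  have \<rho>\<iota>: "\<rho> (\<iota> \<alpha>) = \<alpha>" for \<alpha>
    by (auto simp: \<rho>_def \<iota>_def)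
  have \<iota>_meas: "\<iota> \<in> borel_measurable M"
    unfolding \<iota>_def
  proof (rule measurable_coordinatewise_then_product)
    fix x :: 'v
    have "(\<lambda>\<alpha>. \<alpha> x) \<in> measurable M (count_space UNIV)"
      using measurable_bit[of x] measurable_cong_sets[OF sets_M refl] by blast
    then show "(\<lambda>\<alpha>. of_bool (\<alpha> x) :: real) \<in> borel_measurable M"
      by measurable
  qed
  have \<rho>_meas: "\<rho> \<in> measurable borel bits"
    unfolding \<rho>_def by (rule measurable_PiM_single') auto
  let ?N = "distr M borel \<iota>"
  let ?A = "{\<beta>. \<rho> \<beta> \<in> A \<and> (\<forall>x. \<beta> x = 0 \<or> \<beta> x = 1)}"
  have A': "?A \<in> sets borel"
  proof -
    have "\<rho> -` A \<inter> space borel \<in> sets borel"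
      using A sets_M by (intro measurable_sets[OF \<rho>_meas]) auto
    moreover have "{\<beta> \<in> space (borel :: ('v \<Rightarrow> real) measure). \<forall>x. \<beta> x = 0 \<or> \<beta> x = 1} \<in> sets borel"
      by measurable
    ultimately have "(\<rho> -` A \<inter> space borel) \<inter> {\<beta> \<in> space borel. \<forall>x. \<beta> x = 0 \<or> \<beta> x = 1} \<in> sets borel"
      by (rule sets.Int)
    also have "(\<rho> -` A \<inter> space borel) \<inter> {\<beta> \<in> space borel. \<forall>x. \<beta> x = 0 \<or> \<beta> x = 1} = ?A"
      by auto
    finally show ?thesis .
  qed
  have \<iota>A: "\<iota> -` ?A = A"
    by (auto simp: \<rho>\<iota>) (auto simp: \<iota>_def)
  have NA: "emeasure ?N ?A = ennreal (measure M A)"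
    using A' \<iota>_meas \<iota>A by (simp add: emeasure_distr space_M emeasure_eq_measure)
  obtain D where D: "D \<subseteq> ?A" "compact D" "ennreal (measure M A) \<le> emeasure ?N D + ennreal e"
  proof (cases "measure M A = 0")
    case True
    then show ?thesis by (intro that[of "{}"]) auto
  next
    case False
    have fin: "emeasure ?N (space ?N) \<noteq> \<infinity>"
      using \<iota>_meas by (simp add: emeasure_distr)
    have "ennreal (measure M A - e) < emeasure ?N ?A"
      unfolding NA using e False measure_nonneg[of M A] by (intro ennreal_lessI) linarith+
    then obtain D where D: "D \<subseteq> ?A" "compact D" "ennreal (measure M A - e) < emeasure ?N D"
      unfolding inner_regular[OF sets_distr fin A'] less_SUP_iff by auto
    show ?thesis
    proof (intro that[OF D(1,2)])
      have "ennreal (measure M A) \<le> ennreal (measure M A - e) + ennreal e"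
        using e by (cases "e \<le> measure M A")
          (simp_all add: ennreal_leI flip: ennreal_plus add: ennreal_neg)
      also have "\<dots> \<le> emeasure ?N D + ennreal e"
        using D(3) by (intro add_right_mono) simp
      finally show "ennreal (measure M A) \<le> emeasure ?N D + ennreal e" .
    qed
  qed
  have Db: "D \<in> sets borel"
    using D(2) by (simp add: borel_closed compact_imp_closed)
  have "emeasure ?N D = ennreal (measure M (\<iota> -` D))"
    using Db \<iota>_meas by (simp add: emeasure_distr space_M emeasure_eq_measure)
  with D(3) have "ennreal (measure M A) \<le> ennreal (measure M (\<iota> -` D) + e)"
    using e by simp
  then have "measure M A - e \<le> measure M (\<iota> -` D)"
    using e by (subst (asm) ennreal_le_iff) (auto intro: add_nonneg_nonneg)
  moreover have "\<iota> -` D \<in> sets M"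
    using measurable_sets[OF \<iota>_meas Db] by (simp add: space_M)
  moreover have "\<iota> -` D \<subseteq> A"
    using D(1) \<iota>A by blast
  moreover have "D \<subseteq> range \<iota>"
  proof
    fix \<beta> assume "\<beta> \<in> D"
    then have "\<beta> x = 0 \<or> \<beta> x = 1" for x
      using D(1) by blast
    then have "\<beta> = \<iota> (\<rho> \<beta>)"
      by (auto simp: \<iota>_def \<rho>_def fun_eq_iff)
    then show "\<beta> \<in> range \<iota>" by blast
  qed
  ultimately show ?thesis
    using that D(2) unfolding \<iota>_def by blast
qed

text \<open>If \<open>\<alpha>\<close> dominates some member of a compact set on each finite window, then a limit of these
  members is dominated by \<open>\<alpha>\<close> everywhere. So the cylinder closures of a compact set shrink to its
  upward closure. The windows are initial segments of an enumeration of the vertices.\<close>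

lemma Inter_up_closure_on_compact:
  fixes D :: "('v::countable \<Rightarrow> real) set"
  defines "\<iota> \<equiv> \<lambda>(\<alpha> :: 'v \<Rightarrow> bool) x. of_bool (\<alpha> x) :: real"
  assumes D: "compact D" "D \<subseteq> range \<iota>"
    and \<alpha>: "\<And>n. \<alpha> \<in> up_closure_on {x. to_nat x < (n::nat)} (\<iota> -` D)"
  shows "\<exists>\<beta>\<in>\<iota> -` D. \<beta> \<le> \<alpha>"
proof -
  have "\<forall>n. \<exists>\<beta>. \<iota> \<beta> \<in> D \<and> (\<forall>x. to_nat x < n \<longrightarrow> \<beta> x \<le> \<alpha> x)"
    using \<alpha> by (fastforce simp: up_closure_on_def)
  then obtain \<beta> where \<beta>: "\<And>n. \<iota> (\<beta> n) \<in> D" "\<And>n x. to_nat x < n \<Longrightarrow> \<beta> n x \<le> \<alpha> x"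
    by metis
  obtain l r where l: "l \<in> D" and r: "strict_mono (r :: nat \<Rightarrow> nat)"
    and lim: "(\<lambda>n. \<iota> (\<beta> (r n))) \<longlonglongrightarrow> l"
    using compact_imp_seq_compact[OF D(1)] \<beta>(1) unfolding seq_compact_def
    by (force simp: comp_def)
  from l D(2) obtain \<gamma> where \<gamma>: "l = \<iota> \<gamma>" by auto
  have "\<gamma> x \<le> \<alpha> x" for x
  proof -
    have "(\<lambda>n. \<iota> (\<beta> (r n)) x) \<longlonglongrightarrow> l x"
    proof (rule isCont_tendsto_compose[OF _ lim])
      show "isCont (\<lambda>f. f x) l"
        using continuous_on_product_coordinates
        by (rule continuous_on_interior[of UNIV]) simp
    qed
    \<comment> \<open>Every coordinate eventually lies inside the window, so the bound survives in the limit.\<close>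
    moreover have "eventually (\<lambda>n. \<iota> (\<beta> (r n)) x \<le> \<iota> \<alpha> x) sequentially"
      using eventually_gt_at_top[of "to_nat x"]
    proof eventually_elim
      case (elim n)
      then have "to_nat x < r n"
        using seq_suble[OF r, of n] by linarith
      then show ?case
        using \<beta>(2)[of x "r n"] by (auto simp: \<iota>_def)
    qed
    ultimately have "l x \<le> \<iota> \<alpha> x"
      by (rule tendsto_upperbound) simp
    then show ?thesis
      by (auto simp: \<gamma> \<iota>_def split: if_splits)
  qed
  then show ?thesis
    using l \<gamma> by (intro bexI[of _ \<gamma>]) (auto simp: le_fun_def)
qed

lemma measurable_up_set_inner_approx:
  fixes M :: "('v::countable \<Rightarrow> bool) measure"
  assumes M: "finite_measure M" "sets M = sets bits"
    and A: "A \<in> sets M" "\<And>\<alpha> \<beta>. \<alpha> \<in> A \<Longrightarrow> \<alpha> \<le> \<beta> \<Longrightarrow> \<beta> \<in> A" and e: "0 < e"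
  obtains C where "(\<Inter>n. up_closure_on {x. to_nat x < (n::nat)} C) \<subseteq> A"
    "measure M A - e \<le> measure M (\<Inter>n. up_closure_on {x. to_nat x < (n::nat)} C)"
proof -
  interpret finite_measure M by fact
  let ?\<iota> = "\<lambda>(\<alpha> :: 'v \<Rightarrow> bool) x. of_bool (\<alpha> x) :: real"
  obtain D where D: "compact D" "?\<iota> -` D \<in> sets M" "?\<iota> -` D \<subseteq> A" "D \<subseteq> range ?\<iota>"
    "measure M A - e \<le> measure M (?\<iota> -` D)"
    using inner_regular_bits[OF M A(1) e] .
  have fin: "finite {x::'v. to_nat x < n}" for n
    using finite_vimageI[of "{..<n}" "to_nat :: 'v \<Rightarrow> nat"] by (simp add: vimage_def)
  let ?U = "\<Inter>n. up_closure_on {x. to_nat x < (n::nat)} (?\<iota> -` D)"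
  have U: "?U \<in> sets M"
    unfolding M(2) by (intro sets.countable_INT) (auto intro!: up_closure_on_measurable fin)
  show ?thesis
  proof (rule that)
    show "?U \<subseteq> A"
    proof
      fix \<alpha> assume "\<alpha> \<in> ?U"
      then have "\<exists>\<beta>\<in>?\<iota> -` D. \<beta> \<le> \<alpha>"
        by (intro Inter_up_closure_on_compact[OF D(1,4)]) blast
      then show "\<alpha> \<in> A"
        using D(3) A(2) by blast
    qed
    have "measure M (?\<iota> -` D) \<le> measure M ?U"
      by (rule finite_measure_mono[OF _ U]) (auto simp: up_closure_on_def)
    with D(5) show "measure M A - e \<le> measure M ?U" by linarith
  qed
qed

text \<open>Both events are replaced, up to an error \<open>e\<close>, by decreasing limits of cylinder up-sets contained in
  them; continuity from above carries the cylinder inequality to these limits.\<close>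

lemma positively_correlated_up_sets:
  fixes M :: "('v::countable \<Rightarrow> bool) measure"
  assumes M: "prob_space M" "sets M = sets bits"
    and cyl: "\<And>K C C'. finite K \<Longrightarrow>
      measure M (up_closure_on K C) * measure M (up_closure_on K C')
        \<le> measure M (up_closure_on K C \<inter> up_closure_on K C')"
    and A: "A \<in> sets M" "\<And>\<alpha> \<beta>. \<alpha> \<in> A \<Longrightarrow> \<alpha> \<le> \<beta> \<Longrightarrow> \<beta> \<in> A"
    and B: "B \<in> sets M" "\<And>\<alpha> \<beta>. \<alpha> \<in> B \<Longrightarrow> \<alpha> \<le> \<beta> \<Longrightarrow> \<beta> \<in> B"
  shows "measure M A * measure M B \<le> measure M (A \<inter> B)"
proof -
  interpret prob_space M by fact
  have fin: "finite {x::'v. to_nat x < n}" for n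
    using finite_vimageI[of "{..<n}" "to_nat :: 'v \<Rightarrow> nat"] by (simp add: vimage_def)
  have approx: "(prob A - e) * (prob B - e) \<le> prob (A \<inter> B)" if e: "0 < e" "e < prob A" "e < prob B" for e
  proof -
    let ?U = "\<lambda>C n. up_closure_on {x::'v. to_nat x < (n::nat)} C"
    obtain C where C: "(\<Inter>n. ?U C n) \<subseteq> A" "prob A - e \<le> prob (\<Inter>n. ?U C n)"
      by (rule measurable_up_set_inner_approx[OF finite_measure_axioms M(2) A e(1)])
    obtain C' where C': "(\<Inter>n. ?U C' n) \<subseteq> B" "prob B - e \<le> prob (\<Inter>n. ?U C' n)"
      by (rule measurable_up_set_inner_approx[OF finite_measure_axioms M(2) B e(1)])
    have U: "?U C n \<in> events" for C n
      unfolding M(2) by (rule up_closure_on_measurable[OF fin])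
    have dec: "decseq (?U C)" for C
      by (intro decseq_SucI up_closure_on_antimono) auto
    have lim: "(\<lambda>n. prob (?U C n)) \<longlonglongrightarrow> prob (\<Inter>n. ?U C n)" for C
      using U dec by (intro finite_Lim_measure_decseq) auto
    have "(\<lambda>n. prob (?U C n \<inter> ?U C' n)) \<longlonglongrightarrow> prob (\<Inter>n. ?U C n \<inter> ?U C' n)"
    proof (intro finite_Lim_measure_decseq)
      show "decseq (\<lambda>n. ?U C n \<inter> ?U C' n)"
        using dec[of C] dec[of C'] unfolding decseq_def by blast
    qed (use U in auto)
    then have "prob (\<Inter>n. ?U C n) * prob (\<Inter>n. ?U C' n) \<le> prob (\<Inter>n. ?U C n \<inter> ?U C' n)"
      by (rule LIMSEQ_le[OF tendsto_mult[OF lim lim]]) (auto intro!: cyl fin)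
    also have "\<dots> \<le> prob (A \<inter> B)"
      using A(1) B(1) C(1) C'(1) by (intro finite_measure_mono) auto
    finally have "prob (\<Inter>n. ?U C n) * prob (\<Inter>n. ?U C' n) \<le> prob (A \<inter> B)" .
    moreover have "(prob A - e) * (prob B - e) \<le> prob (\<Inter>n. ?U C n) * prob (\<Inter>n. ?U C' n)"
      using C(2) C'(2) e by (intro mult_mono) auto
    ultimately show ?thesis by linarith
  qed
  show ?thesis
  proof (cases "prob A = 0 \<or> prob B = 0")
    case True
    then show ?thesis by auto
  next
    case False
    then have pos: "0 < min (prob A) (prob B)"
      by (simp add: zero_less_measure_iff)
    have "((\<lambda>e. (prob A - e) * (prob B - e)) \<longlongrightarrow> (prob A - 0) * (prob B - 0)) (at_right 0)"
      by (intro tendsto_intros)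
    moreover have "eventually (\<lambda>e. (prob A - e) * (prob B - e) \<le> prob (A \<inter> B)) (at_right 0)"
      using eventually_at_right_less[of 0] eventually_at_right_real[OF pos]
      by eventually_elim (auto intro: approx)
    ultimately have "(prob A - 0) * (prob B - 0) \<le> prob (A \<inter> B)"
      by (rule tendsto_upperbound) simp
    then show ?thesis by simp
  qed
qed

section \<open>From level sets to square-integrable functions\<close>

text \<open>The identity truncated to \<open>[- n, n]\<close> and rounded down to the grid of mesh \<open>1 / (n + 1)\<close>, written as
  a positive combination of indicators of half-lines minus a constant. This form makes composition
  with \<open>h\<close> a combination of upper level sets of \<open>h\<close>.\<close>

definition staircase :: "nat \<Rightarrow> real \<Rightarrow> real" where
  "staircase n t =
     (\<Sum>k\<in>{1..2 * n * (n + 1)}. of_bool (real k / (real n + 1) - n \<le> t)) / (real n + 1) - n"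

lemma staircase_eq:
  "staircase n t = real (min (2 * n * (n + 1)) (nat \<lfloor>(t + real n) * (real n + 1)\<rfloor>)) / (real n + 1) - n"
proof -
  let ?N = "2 * n * (n + 1)"
  have iff: "real k / (real n + 1) - n \<le> t \<longleftrightarrow> k \<le> nat \<lfloor>(t + real n) * (real n + 1)\<rfloor>" if "1 \<le> k" for k
  proof -
    have "real k / (real n + 1) - n \<le> t \<longleftrightarrow> real k \<le> (t + real n) * (real n + 1)"
      by (simp add: field_simps)
    also have "\<dots> \<longleftrightarrow> int k \<le> \<lfloor>(t + real n) * (real n + 1)\<rfloor>"
      by (simp add: le_floor_iff)
    also have "\<dots> \<longleftrightarrow> k \<le> nat \<lfloor>(t + real n) * (real n + 1)\<rfloor>"
      using that by linarith
    finally show ?thesis .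
  qed
  have "(\<Sum>k\<in>{1..?N}. of_bool (real k / (real n + 1) - n \<le> t)) =
      (\<Sum>k\<in>{1..?N}. of_bool (k \<le> nat \<lfloor>(t + real n) * (real n + 1)\<rfloor>) :: real)"
    using iff by (intro sum.cong) auto
  also have "\<dots> = real (card ({1..?N} \<inter> {k. k \<le> nat \<lfloor>(t + real n) * (real n + 1)\<rfloor>}))"
    by (intro sum_of_bool_eq finite_atLeastAtMost)
  also have "{1..?N} \<inter> {k. k \<le> nat \<lfloor>(t + real n) * (real n + 1)\<rfloor>} = {1..min ?N (nat \<lfloor>(t + real n) * (real n + 1)\<rfloor>)}"
    by auto
  finally show ?thesis
    unfolding staircase_def by (simp only: card_atLeastAtMost diff_Suc_1)
qed

lemma staircase_near:
  assumes "\<bar>t\<bar> \<le> real n"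
  shows "\<bar>staircase n t - t\<bar> \<le> 1 / (real n + 1)"
proof -
  let ?y = "(t + real n) * (real n + 1)"
  have y: "0 \<le> ?y" "?y \<le> (2 * real n) * (real n + 1)"
    using assms by (auto intro!: mult_right_mono mult_nonneg_nonneg simp del: distrib_left distrib_right)
  have "real_of_int (int (2 * n * (n + 1))) = (2 * real n) * (real n + 1)"
    by (simp add: algebra_simps)
  with y(2) have "?y \<le> of_int (int (2 * n * (n + 1)))"
    by (simp only:)
  then have "\<lfloor>?y\<rfloor> \<le> int (2 * n * (n + 1))"
    using floor_mono[of ?y "of_int (int (2 * n * (n + 1)))"] unfolding floor_of_int by simp
  then have "staircase n t = of_int \<lfloor>?y\<rfloor> / (real n + 1) - n"
  proof -
    have "nat \<lfloor>?y\<rfloor> \<le> 2 * n * (n + 1)"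
      using \<open>\<lfloor>?y\<rfloor> \<le> int (2 * n * (n + 1))\<close> unfolding nat_le_iff .
    then have "real (min (2 * n * (n + 1)) (nat \<lfloor>?y\<rfloor>)) = real (nat \<lfloor>?y\<rfloor>)"
      by (simp only: min_absorb2)
    then show ?thesis
      using y(1) unfolding staircase_eq by (simp only: of_nat_nat zero_le_floor)
  qed
  moreover have "t = ?y / (real n + 1) - n"
    by simp
  ultimately have "staircase n t - t = (of_int \<lfloor>?y\<rfloor> - ?y) / (real n + 1)"
    by (metis (no_types, lifting) diff_diff_eq2 diff_divide_distrib add_diff_cancel diff_add_cancel
        diff_add_eq)
  moreover have "\<bar>of_int \<lfloor>?y\<rfloor> - ?y\<bar> \<le> 1"
    by linarith
  ultimately show ?thesis
    by (simp add: abs_divide divide_right_mono)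
qed

lemma staircase_tendsto: "(\<lambda>n. staircase n t) \<longlonglongrightarrow> t"
proof -
  have "(\<lambda>n. staircase n t - t) \<longlonglongrightarrow> 0"
  proof (rule Lim_null_comparison)
    show "eventually (\<lambda>n. norm (staircase n t - t) \<le> 1 / real (Suc n)) sequentially"
      using eventually_ge_at_top[of "nat \<lceil>\<bar>t\<bar>\<rceil>"]
      by eventually_elim (use staircase_near in \<open>auto simp: add.commute intro!: staircase_near\<close>)
  qed (use LIMSEQ_inverse_real_of_nat in \<open>simp add: inverse_eq_divide\<close>)
  then show ?thesis by (simp add: LIM_zero_iff)
qed

lemma abs_staircase_le: "\<bar>staircase n t\<bar> \<le> \<bar>t\<bar> + 1"
proof (cases "\<bar>t\<bar> \<le> real n")
  case True
  have "1 / (real n + 1) \<le> 1"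
    by simp
  with staircase_near[OF True] show ?thesis by linarith
next
  case False
  have "0 \<le> staircase n t + n"
    by (simp add: staircase_eq)
  moreover have "staircase n t + n \<le> 2 * n"
  proof -
    have "real (min (2 * n * (n + 1)) (nat \<lfloor>(t + real n) * (real n + 1)\<rfloor>)) \<le> real (2 * n * (n + 1))"
      by linarith
    then have "real (min (2 * n * (n + 1)) (nat \<lfloor>(t + real n) * (real n + 1)\<rfloor>)) / (real n + 1)
        \<le> real (2 * n * (n + 1)) / (real n + 1)"
      by (intro divide_right_mono) auto
    also have "\<dots> = 2 * n" by (simp add: field_simps)
    finally show ?thesis by (simp add: staircase_eq)
  qed
  ultimately show ?thesis using False by linarith
qed

lemma integrable_product_of_squares:
  fixes f g :: "'a \<Rightarrow> real"
  assumes "f \<in> borel_measurable M" "g \<in> borel_measurable M"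
    and "integrable M (\<lambda>x. (f x)\<^sup>2)" "integrable M (\<lambda>x. (g x)\<^sup>2)"
  shows "integrable M (\<lambda>x. f x * g x)"
proof (rule Bochner_Integration.integrable_bound)
  show "integrable M (\<lambda>x. (f x)\<^sup>2 + (g x)\<^sup>2)"
    using assms by simp
  have "\<bar>a * b\<bar> \<le> a\<^sup>2 + b\<^sup>2" for a b :: real
  proof -
    have "2 * (\<bar>a\<bar> * \<bar>b\<bar>) \<le> a\<^sup>2 + b\<^sup>2"
      using sum_squares_bound[of "\<bar>a\<bar>" "\<bar>b\<bar>"] by simp
    moreover have "0 \<le> \<bar>a\<bar> * \<bar>b\<bar>"
      by simp
    ultimately show ?thesis
      unfolding abs_mult by linarith
  qed
  then show "AE x in M. norm (f x * g x) \<le> norm ((f x)\<^sup>2 + (g x)\<^sup>2)"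
    by auto
qed (use assms in measurable)

text \<open>One factor at a time: with \<open>\<phi>\<close> fixed, the hypothesis passes from the level sets of \<open>h\<close> to the
  staircase approximations by linearity, and then to \<open>h\<close> by dominated convergence.\<close>

lemma (in prob_space) covariance_nonneg_if_level_sets:
  fixes \<phi> h :: "'a \<Rightarrow> real"
  assumes [measurable]: "\<phi> \<in> borel_measurable M" "h \<in> borel_measurable M"
    and sq: "integrable M (\<lambda>x. (\<phi> x)\<^sup>2)" "integrable M (\<lambda>x. (h x)\<^sup>2)"
    and lev: "\<And>t. expectation \<phi> * prob {x \<in> space M. t \<le> h x}
      \<le> expectation (\<lambda>x. \<phi> x * of_bool (t \<le> h x))"
  shows "expectation \<phi> * expectation h \<le> expectation (\<lambda>x. \<phi> x * h x)"
proof -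
  have i1: "integrable M \<phi>" "integrable M h"
    using sq by (auto intro: square_integrable_imp_integrable)
  have i2: "integrable M (\<lambda>x. \<phi> x * h x)"
    by (rule integrable_product_of_squares) (use sq in auto)
  have [measurable]: "(\<lambda>x. staircase n (h x)) \<in> borel_measurable M" for n
    unfolding staircase_def by measurable
  have il: "integrable M (\<lambda>x. of_bool (t \<le> h x) :: real)" for t
    by (rule integrable_const_bound[of _ 1]) auto
  have il\<phi>: "integrable M (\<lambda>x. \<phi> x * of_bool (t \<le> h x))" for t
    by (rule Bochner_Integration.integrable_bound[OF i1(1)]) auto
  have el: "expectation (\<lambda>x. of_bool (t \<le> h x)) = prob {x \<in> space M. t \<le> h x}" for t
  proof -
    have "expectation (\<lambda>x. of_bool (t \<le> h x)) = expectation (indicator {x \<in> space M. t \<le> h x})"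
      by (rule Bochner_Integration.integral_cong) auto
    also have "\<dots> = prob {x \<in> space M. t \<le> h x}"
      by simp
    finally show ?thesis .
  qed
  have step: "expectation \<phi> * expectation (\<lambda>x. staircase n (h x))
      \<le> expectation (\<lambda>x. \<phi> x * staircase n (h x))" for n
  proof -
    let ?I = "{1..2 * n * (n + 1)}"
    let ?t = "\<lambda>k. real k / (real n + 1) - n"
    have "expectation (\<lambda>x. staircase n (h x)) =
        (\<Sum>k\<in>?I. prob {x \<in> space M. ?t k \<le> h x}) / (real n + 1) - n"
      unfolding staircase_def using il
      by (simp add: el prob_space del: sum_of_bool_eq)
    moreover have "expectation (\<lambda>x. \<phi> x * staircase n (h x)) =
        (\<Sum>k\<in>?I. expectation (\<lambda>x. \<phi> x * of_bool (?t k \<le> h x))) / (real n + 1) - expectation \<phi> * n"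
      unfolding staircase_def right_diff_distrib sum_distrib_left times_divide_eq_right
      using il\<phi> i1 by (simp del: sum_of_bool_eq sum_mult_of_bool_eq)
    moreover have "(\<Sum>k\<in>?I. expectation \<phi> * prob {x \<in> space M. ?t k \<le> h x}) / (real n + 1)
        \<le> (\<Sum>k\<in>?I. expectation (\<lambda>x. \<phi> x * of_bool (?t k \<le> h x))) / (real n + 1)"
      by (intro divide_right_mono sum_mono lev) auto
    ultimately show ?thesis
      by (simp add: right_diff_distrib sum_distrib_left)
  qed
  have "(\<lambda>n. expectation (\<lambda>x. staircase n (h x))) \<longlonglongrightarrow> expectation h"
  proof (rule integral_dominated_convergence)
    show "integrable M (\<lambda>x. \<bar>h x\<bar> + 1)"
      using i1 by simp
  qed (use staircase_tendsto abs_staircase_le in auto)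
  moreover have "(\<lambda>n. expectation (\<lambda>x. \<phi> x * staircase n (h x))) \<longlonglongrightarrow> expectation (\<lambda>x. \<phi> x * h x)"
  proof (rule integral_dominated_convergence)
    show "integrable M (\<lambda>x. \<bar>\<phi> x * h x\<bar> + \<bar>\<phi> x\<bar>)"
      using i1 i2 by simp
    have "\<bar>\<phi> x * staircase n (h x)\<bar> \<le> \<bar>\<phi> x * h x\<bar> + \<bar>\<phi> x\<bar>" for x n
      using mult_left_mono[OF abs_staircase_le[of n "h x"] abs_ge_zero[of "\<phi> x"]]
      by (simp add: abs_mult distrib_left)
    then show "AE x in M. norm (\<phi> x * staircase n (h x)) \<le> \<bar>\<phi> x * h x\<bar> + \<bar>\<phi> x\<bar>" for n
      by simp
  qed (auto intro!: tendsto_mult staircase_tendsto)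
  ultimately show ?thesis
    using step by (intro LIMSEQ_le[OF tendsto_mult[OF tendsto_const]]) auto
qed

text \<open>The one-factor lemma is applied twice: first with an indicator of a level set of \<open>g\<close> as the fixed
  factor, then with \<open>f\<close> itself.\<close>

lemma (in prob_space) covariance_nonneg_if_level_sets_correlated:
  fixes f g :: "'a \<Rightarrow> real"
  assumes [measurable]: "f \<in> borel_measurable M" "g \<in> borel_measurable M"
    and sq: "integrable M (\<lambda>x. (f x)\<^sup>2)" "integrable M (\<lambda>x. (g x)\<^sup>2)"
    and lev: "\<And>s t. prob {x \<in> space M. s \<le> f x} * prob {x \<in> space M. t \<le> g x}
      \<le> prob {x \<in> space M. s \<le> f x \<and> t \<le> g x}"
  shows "expectation f * expectation g \<le> expectation (\<lambda>x. f x * g x)"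
proof (rule covariance_nonneg_if_level_sets)
  fix t
  have ind: "expectation (\<lambda>x. of_bool (P x)) = prob {x \<in> space M. P x}"
    if "{x \<in> space M. P x} \<in> events" for P
  proof -
    have "expectation (\<lambda>x. of_bool (P x)) = expectation (indicator {x \<in> space M. P x})"
      by (rule Bochner_Integration.integral_cong) auto
    also have "\<dots> = prob {x \<in> space M. P x}"
      using that by simp
    finally show ?thesis .
  qed
  have "expectation (\<lambda>x. of_bool (t \<le> g x)) * expectation f
      \<le> expectation (\<lambda>x. of_bool (t \<le> g x) * f x)"
  proof (rule covariance_nonneg_if_level_sets)
    show "integrable M (\<lambda>x. (of_bool (t \<le> g x) :: real)\<^sup>2)"
      by (rule integrable_const_bound[of _ 1]) auto
    fix s
    have "expectation (\<lambda>x. of_bool (t \<le> g x) * of_bool (s \<le> f x) :: real) =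
        expectation (\<lambda>x. of_bool (s \<le> f x \<and> t \<le> g x))"
      by (rule Bochner_Integration.integral_cong) auto
    then show "expectation (\<lambda>x. of_bool (t \<le> g x)) * prob {x \<in> space M. s \<le> f x}
        \<le> expectation (\<lambda>x. of_bool (t \<le> g x) * of_bool (s \<le> f x))"
      using lev[of s t] by (simp add: ind mult.commute)
  qed (use sq in auto)
  then show "expectation f * prob {x \<in> space M. t \<le> g x}
      \<le> expectation (\<lambda>x. f x * of_bool (t \<le> g x))"
    by (simp add: ind mult.commute)
qed (use sq in auto)

section \<open>Vacant sets as monotone functions of independent bits\<close>

lemma num_points_eq_0_iff: "num_points \<omega> D = 0 \<longleftrightarrow> (\<forall>p\<in>D. \<omega> p = 0)"
  using null_sets_point_measure_iff[of D UNIV "\<lambda>p. of_nat (\<omega> p)"]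
  by (auto simp: num_points_def null_sets_def sets_point_measure)

lemma num_points_measurable:
  assumes "D \<in> sets N"
  shows "(\<lambda>\<omega>. num_points \<omega> D) \<in> borel_measurable (config_space N)"
proof (rule measurableI)
  let ?G = "{{\<omega> \<in> point_configs N. num_points \<omega> D \<in> B} | D B. D \<in> sets N \<and> B \<in> sets borel}"
  have G: "?G \<subseteq> Pow (point_configs N)"
    by auto
  fix B :: "ennreal set" assume "B \<in> sets borel"
  with assms have "{\<omega> \<in> point_configs N. num_points \<omega> D \<in> B} \<in> sets (config_space N)"
    unfolding config_space_def sets_measure_of[OF G] by (intro sigma_sets.Basic) blast
  moreover have "(\<lambda>\<omega>. num_points \<omega> D) -` B \<inter> space (config_space N) =
      {\<omega> \<in> point_configs N. num_points \<omega> D \<in> B}"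
    unfolding config_space_def space_measure_of[OF G] by auto
  ultimately show "(\<lambda>\<omega>. num_points \<omega> D) -` B \<inter> space (config_space N) \<in> sets (config_space N)"
    by simp
qed simp

lemma space_config_space: "space (config_space N) = point_configs N"
  unfolding config_space_def by (rule space_measure_of) auto

text \<open>All representatives of a class are time shifts of each other and visit the same vertices.\<close>

lemma class_range_shift_class:
  assumes "w \<in> trajectories E"
  shows "class_range (shift_class E w) = range w"
proof
  show "class_range (shift_class E w) \<subseteq> range w"
    by (auto simp: class_range_def shift_class_def shift_rel_def)
  have "w \<in> shift_class E w"
    using assms unfolding shift_class_def shift_rel_def by (auto intro!: exI[of _ 0])
  then show "range w \<subseteq> class_range (shift_class E w)"
    by (auto simp: class_range_def)
qed

text \<open>The sets on which the point process is counted: for fixed \<open>K\<close> they partition the trajectory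
  classes as \<open>S\<close> ranges over the subsets of \<open>K\<close>.\<close>

definition trace_classes :: "'v set set \<Rightarrow> 'v set \<Rightarrow> 'v set \<Rightarrow> (int \<Rightarrow> 'v) set set" where
  "trace_classes E K S = {c \<in> trajectories E // shift_rel E. class_range c \<inter> K = S}"

lemma sets_class_space_eq:
  "sets (class_space E) = sigma_sets (trajectories E // shift_rel E)
     {A. A \<subseteq> trajectories E // shift_rel E \<and>
         {w \<in> trajectories E. shift_class E w \<in> A} \<in> sets (trajectory_space E)}"
  unfolding class_space_def by (rule sets_measure_of) auto

lemma space_class_space: "space (class_space E) = trajectories E // shift_rel E"
  unfolding class_space_def by (rule space_measure_of) auto

lemma trace_classes_measurable:
  fixes E :: "'v::countable set set"
  shows "trace_classes E K S \<in> sets (class_space E)"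
proof -
  let ?T = "\<Pi>\<^sub>M n\<in>(UNIV::int set). count_space (UNIV :: 'v set)"
  have space_T: "space ?T = UNIV"
    by (simp add: space_PiM)
  have coord: "(\<lambda>w. w n) \<in> measurable ?T (count_space UNIV)" for n
    by (rule measurable_component_singleton) simp
  have "{w \<in> trajectories E. shift_class E w \<in> trace_classes E K S} =
      {w \<in> trajectories E. range w \<inter> K = S}"
    using class_range_shift_class[of _ E]
    by (auto simp: trace_classes_def shift_class_def quotient_def)
  also have "\<dots> = {w \<in> space ?T. \<forall>x. (x \<in> K \<and> (\<exists>n. w n = x)) = (x \<in> S)} \<inter> trajectories E"
    unfolding space_T by (auto simp: set_eq_iff) (metis rangeI image_iff)+
  also have "\<dots> \<in> sets (trajectory_space E)"
  proof -
    have "{w \<in> space ?T. \<forall>x. (x \<in> K \<and> (\<exists>n. w n = x)) = (x \<in> S)} \<in> sets ?T"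
      using coord by measurable
    then show ?thesis
      unfolding trajectory_space_def sets_restrict_space by blast
  qed
  finally show ?thesis
    unfolding sets_class_space_eq by (intro sigma_sets.Basic) (auto simp: trace_classes_def)
qed

lemma trace_classes_slab_measurable:
  fixes E :: "'v::countable set set" and u :: real
  assumes "sets \<nu> = sets (class_space E)"
  shows "trace_classes E K S \<times> {0..u} \<in> sets (\<nu> \<Otimes>\<^sub>M restrict_space lborel {0..})"
proof (rule pair_measureI)
  show "trace_classes E K S \<in> sets \<nu>"
    using assms trace_classes_measurable by blast
  show "{0..u} \<in> sets (restrict_space lborel {0..})"
    by (subst sets_restrict_space_iff) auto
qed

text \<open>The class of a trajectory covering \<open>x\<close> belongs to exactly one trace \<open>S\<close>, and this \<open>S\<close> contains \<open>x\<close>.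
  So vacancy of \<open>x\<close> is a conjunction of the bits ``no points with trace \<open>S\<close>'', hence
  increasing in them.\<close>

lemma vacant_iff_no_trace_points:
  assumes \<omega>: "\<omega> \<in> point_configs (\<nu> \<Otimes>\<^sub>M restrict_space lborel {0..})"
    and \<nu>: "sets \<nu> = sets (class_space E)" and x: "x \<in> K"
  shows "x \<in> vacant_set u \<omega> \<longleftrightarrow>
    (\<forall>S\<in>Pow K. x \<in> S \<longrightarrow> num_points \<omega> (trace_classes E K S \<times> {0..u}) = 0)"
proof -
  have sp: "c \<in> trajectories E // shift_rel E \<and> 0 \<le> t" if "\<omega> (c, t) \<noteq> 0" for c t
  proof -
    have "(c, t) \<in> space \<nu> \<times> space (restrict_space lborel {0..})"
      using that \<omega> unfolding point_configs_def space_pair_measure by blast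
    then show ?thesis
      using sets_eq_imp_space_eq[OF \<nu>] by (simp add: space_class_space space_restrict_space)
  qed
  have "x \<in> vacant_set u \<omega> \<longleftrightarrow> (\<forall>c t. \<omega> (c, t) \<noteq> 0 \<longrightarrow> t \<le> u \<longrightarrow> x \<notin> class_range c)"
    unfolding vacant_set_def interlacement_def by blast
  also have "\<dots> \<longleftrightarrow> (\<forall>S\<in>Pow K. x \<in> S \<longrightarrow> num_points \<omega> (trace_classes E K S \<times> {0..u}) = 0)"
    unfolding num_points_eq_0_iff
  proof (intro iffI allI ballI impI notI)
    fix S p
    assume *: "\<forall>c t. \<omega> (c, t) \<noteq> 0 \<longrightarrow> t \<le> u \<longrightarrow> x \<notin> class_range c" "x \<in> S"
      "p \<in> trace_classes E K S \<times> {0..u}"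
    then have "x \<in> class_range (fst p)" "snd p \<le> u"
      by (auto simp: trace_classes_def)
    with *(1)[rule_format, of "fst p" "snd p"] show "\<omega> p = 0"
      by auto
  next
    fix c t
    assume *: "\<forall>S\<in>Pow K. x \<in> S \<longrightarrow> (\<forall>p\<in>trace_classes E K S \<times> {0..u}. \<omega> p = 0)"
      "\<omega> (c, t) \<noteq> 0" "t \<le> u" "x \<in> class_range c"
    have "(c, t) \<in> trace_classes E K (class_range c \<inter> K) \<times> {0..u}"
      using sp[OF *(2)] *(3) by (auto simp: trace_classes_def)
    moreover have "class_range c \<inter> K \<in> Pow K" "x \<in> class_range c \<inter> K"
      using *(4) x by auto
    ultimately have "\<omega> (c, t) = 0"
      using *(1) by metis
    with *(2) show False by simp
  qed
  finally show ?thesis .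
qed

locale interlacement_process =
  fixes E :: "'v::countable set set" and P :: "((int \<Rightarrow> 'v) set \<times> real \<Rightarrow> nat) measure"
    and \<nu> :: "(int \<Rightarrow> 'v) set measure" and u :: real
  assumes sets_\<nu>: "sets \<nu> = sets (class_space E)"
    and poisson: "is_poisson_law (\<nu> \<Otimes>\<^sub>M restrict_space lborel {0..}) P"
begin

abbreviation "N \<equiv> \<nu> \<Otimes>\<^sub>M restrict_space lborel {0::real..}"

abbreviation "vacant \<equiv> \<lambda>\<omega> x. x \<in> vacant_set u \<omega>"

sublocale prob_space P
  using poisson by (simp add: is_poisson_law_def)

lemma sets_P: "sets P = sets (config_space N)"
  using poisson by (simp add: is_poisson_law_def)

lemma space_P: "space P = point_configs N"
  using sets_eq_imp_space_eq[OF sets_P] by (simp add: space_config_space)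

text \<open>Taking \<open>K = {x}\<close> turns vacancy of \<open>x\<close> into the vanishing of a single count, which is measurable.
  This makes the image measure defining the vacant law a probability measure.\<close>

lemma vacant_measurable: "vacant \<in> measurable P bits"
proof (rule measurable_PiM_single')
  fix x :: 'v
  have [measurable]: "(\<lambda>\<omega>. num_points \<omega> (trace_classes E {x} {x} \<times> {0..u})) \<in> borel_measurable P"
    using num_points_measurable[OF trace_classes_slab_measurable[OF sets_\<nu>]]
      measurable_cong_sets[OF sets_P refl] by blast
  have "(\<lambda>\<omega>. num_points \<omega> (trace_classes E {x} {x} \<times> {0..u}) = 0) \<in> measurable P (count_space UNIV)"
    by measurable
  also have "?this \<longleftrightarrow> (\<lambda>\<omega>. vacant \<omega> x) \<in> measurable P (count_space UNIV)"
  proof (rule measurable_cong)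
    fix \<omega> assume "\<omega> \<in> space P"
    then show "(num_points \<omega> (trace_classes E {x} {x} \<times> {0..u}) = 0) = vacant \<omega> x"
      using vacant_iff_no_trace_points[of \<omega> \<nu> E x "{x}" u] sets_\<nu> space_P
      by (auto simp: Pow_insert)
  qed
  finally show "(\<lambda>\<omega>. vacant \<omega> x) \<in> measurable P (count_space UNIV)" .
qed auto

text \<open>Complete independence of the Poisson process makes the bits ``no points with trace \<open>S\<close>''
  independent, and \<open>vacant_iff_no_trace_points\<close> makes cylinder up-sets increasing in them, so
  Harris' inequality applies.\<close>

lemma vacant_cylinder_correlated:
  assumes K: "finite K"
  shows "prob (vacant -` up_closure_on K C \<inter> space P) * prob (vacant -` up_closure_on K C' \<inter> space P)
    \<le> prob (vacant -` (up_closure_on K C \<inter> up_closure_on K C') \<inter> space P)"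
proof -
  obtain S :: "nat \<Rightarrow> 'v set" and m where S: "Pow K = S ` {..<m}" "inj_on S {..<m}"
    using finite_imp_nat_seg_image_inj_on[of "Pow K"] K unfolding lessThan_def by auto
  define D where "D i = trace_classes E K (S i) \<times> {0..u}" for i
  have D: "D i \<in> sets N" for i
    unfolding D_def by (rule trace_classes_slab_measurable[OF sets_\<nu>])
  have disj: "disjoint_family_on D {..<m}"
    using S(2) by (fastforce simp: disjoint_family_on_def D_def trace_classes_def inj_on_def)
  have "indep_vars (\<lambda>_. borel) (\<lambda>i \<omega>. num_points \<omega> (D i)) {..<m}"
  proof -
    have "\<forall>(n::nat) D. D ` {..<n} \<subseteq> sets N \<and> disjoint_family_on D {..<n} \<longrightarrow>
        indep_vars (\<lambda>_. borel) (\<lambda>i \<omega>. num_points \<omega> (D i)) {..<n}"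
      using poisson unfolding is_poisson_law_def by blast
    moreover have "D ` {..<m} \<subseteq> sets N"
      using D by blast
    ultimately show ?thesis
      using disj by blast
  qed
  then have indep: "indep_vars (\<lambda>_. count_space UNIV) (\<lambda>i \<omega>. num_points \<omega> (D i) = 0) {..<m}"
    by (rule indep_vars_compose2) measurable
  \<comment> \<open>\<open>?a z\<close> rebuilds the vacant set inside \<open>K\<close> from the bits \<open>z\<close>; off \<open>K\<close> it is constantly true, which
    \<open>up_closure_on K\<close> does not see.\<close>
  let ?Z = "\<lambda>\<omega> i. i \<in> {..<m} \<and> num_points \<omega> (D i) = 0"
  let ?a = "\<lambda>z x. \<forall>i<m. x \<in> S i \<longrightarrow> z i"
  define F :: "('v \<Rightarrow> bool) set \<Rightarrow> (nat \<Rightarrow> bool) \<Rightarrow> real"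
    where "F C z = of_bool (?a z \<in> up_closure_on K C)" for C z
  have mono: "mono (F C)" for C
  proof (rule monoI)
    fix z z' :: "nat \<Rightarrow> bool" assume "z \<le> z'"
    then have "?a z \<in> up_closure_on K C \<Longrightarrow> ?a z' \<in> up_closure_on K C"
      unfolding up_closure_on_def le_fun_def le_bool_def by blast
    then show "F C z \<le> F C z'" by (auto simp: F_def)
  qed
  have vac: "F C (?Z \<omega>) = of_bool (vacant \<omega> \<in> up_closure_on K C)" if "\<omega> \<in> space P" for \<omega> C
  proof -
    have "vacant \<omega> x \<longleftrightarrow> ?a (?Z \<omega>) x" if "x \<in> K" for x
    proof -
      have "vacant \<omega> x \<longleftrightarrow> (\<forall>T\<in>S ` {..<m}. x \<in> T \<longrightarrow> num_points \<omega> (trace_classes E K T \<times> {0..u}) = 0)"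
        using vacant_iff_no_trace_points[OF _ sets_\<nu> that, of \<omega> u] \<open>\<omega> \<in> space P\<close>
        unfolding space_P S(1) by blast
      also have "\<dots> \<longleftrightarrow> ?a (?Z \<omega>) x"
        by (auto simp: D_def)
      finally show ?thesis .
    qed
    then have "(\<forall>x\<in>K. \<beta> x \<le> vacant \<omega> x) \<longleftrightarrow> (\<forall>x\<in>K. \<beta> x \<le> ?a (?Z \<omega>) x)" for \<beta>
      by simp
    then show ?thesis
      unfolding F_def up_closure_on_def by simp
  qed
  have ind: "expectation (\<lambda>\<omega>. of_bool (vacant \<omega> \<in> B)) = prob (vacant -` B \<inter> space P)"
    if "B \<in> sets bits" for B
  proof -
    have "expectation (\<lambda>\<omega>. of_bool (vacant \<omega> \<in> B)) = expectation (indicator (vacant -` B \<inter> space P))"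
      by (rule Bochner_Integration.integral_cong) auto
    also have "\<dots> = prob (vacant -` B \<inter> space P)"
      using measurable_sets[OF vacant_measurable that] by simp
    finally show ?thesis .
  qed
  have E1: "expectation (\<lambda>\<omega>. F C (?Z \<omega>)) = prob (vacant -` up_closure_on K C \<inter> space P)" for C
    unfolding ind[OF up_closure_on_measurable[OF K], symmetric]
    by (intro Bochner_Integration.integral_cong refl vac)
  have "expectation (\<lambda>\<omega>. F C (?Z \<omega>) * F C' (?Z \<omega>)) =
      expectation (\<lambda>\<omega>. of_bool (vacant \<omega> \<in> up_closure_on K C \<inter> up_closure_on K C'))"
    by (intro Bochner_Integration.integral_cong refl) (simp only: vac of_bool_conj Int_iff)
  also have "\<dots> = prob (vacant -` (up_closure_on K C \<inter> up_closure_on K C') \<inter> space P)"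
    by (intro ind sets.Int up_closure_on_measurable K)
  finally show ?thesis
    using Harris_indep_bits[OF _ indep mono mono, of C C'] unfolding E1 by simp
qed

lemma sets_vacant_law: "sets (vacant_law P u) = sets bits"
  by (simp add: vacant_law_def)

lemma prob_space_vacant_law: "prob_space (vacant_law P u)"
  unfolding vacant_law_def by (rule prob_space_distr[OF vacant_measurable])

lemma vacant_law_up_sets_correlated:
  assumes "A \<in> sets bits" "\<And>\<alpha> \<beta>. \<alpha> \<in> A \<Longrightarrow> \<alpha> \<le> \<beta> \<Longrightarrow> \<beta> \<in> A"
    and "B \<in> sets bits" "\<And>\<alpha> \<beta>. \<alpha> \<in> B \<Longrightarrow> \<alpha> \<le> \<beta> \<Longrightarrow> \<beta> \<in> B"
  shows "measure (vacant_law P u) A * measure (vacant_law P u) B \<le> measure (vacant_law P u) (A \<inter> B)"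
proof (rule positively_correlated_up_sets[OF prob_space_vacant_law sets_vacant_law])
  have law: "measure (vacant_law P u) B = prob (vacant -` B \<inter> space P)" if "B \<in> sets bits" for B
    unfolding vacant_law_def by (rule measure_distr[OF vacant_measurable that])
  fix K :: "'v set" and C C' assume K: "finite K"
  show "measure (vacant_law P u) (up_closure_on K C) * measure (vacant_law P u) (up_closure_on K C')
      \<le> measure (vacant_law P u) (up_closure_on K C \<inter> up_closure_on K C')"
    using vacant_cylinder_correlated[OF K]
    by (simp add: law up_closure_on_measurable[OF K] sets.Int)
qed (use assms sets_vacant_law in auto)

end

theorem theorem3p1:
  fixes E :: "'v::countable set set" and a :: "'v \<Rightarrow> 'v \<Rightarrow> real"
    and P :: "((int \<Rightarrow> 'v) set \<times> real \<Rightarrow> nat) measure"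
    and u :: real and f g :: "('v \<Rightarrow> bool) \<Rightarrow> real"
  assumes "transient_weighted_graph E a"
    and "is_interlacement_law E a P"
    and "0 \<le> u"
    and "f \<in> borel_measurable (vacant_law P u)" and "mono f"
    and "integrable (vacant_law P u) (\<lambda>\<alpha>. (f \<alpha>)\<^sup>2)"
    and "g \<in> borel_measurable (vacant_law P u)" and "mono g"
    and "integrable (vacant_law P u) (\<lambda>\<alpha>. (g \<alpha>)\<^sup>2)"
  shows "(\<integral>\<alpha>. f \<alpha> * g \<alpha> \<partial>vacant_law P u) \<ge>
         (\<integral>\<alpha>. f \<alpha> \<partial>vacant_law P u) * (\<integral>\<alpha>. g \<alpha> \<partial>vacant_law P u)"
proof -
  obtain \<nu> where "is_interlacement_intensity E a \<nu>"
    "is_poisson_law (\<nu> \<Otimes>\<^sub>M restrict_space lborel {0..}) P"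
    using assms(2) unfolding is_interlacement_law_def by blast
  then interpret interlacement_process E P \<nu> u
    by unfold_locales (auto simp: is_interlacement_intensity_def)
  interpret Q: prob_space "vacant_law P u"
    by (rule prob_space_vacant_law)
  have space_Q: "space (vacant_law P u) = UNIV"
    by (simp add: vacant_law_def space_bits)
  have level: "{\<alpha>. t \<le> h \<alpha>} \<in> sets bits" if "h \<in> borel_measurable (vacant_law P u)"
    for t and h :: "('v \<Rightarrow> bool) \<Rightarrow> real"
  proof -
    have "{\<alpha> \<in> space (vacant_law P u). t \<le> h \<alpha>} \<in> sets (vacant_law P u)"
      using that by measurable
    then show ?thesis
      by (simp add: space_Q sets_vacant_law)
  qed
  show ?thesis
  proof (rule Q.covariance_nonneg_if_level_sets_correlated[OF assms(4,7,6,9)])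
    fix s t
    have "measure (vacant_law P u) {\<alpha>. s \<le> f \<alpha>} * measure (vacant_law P u) {\<alpha>. t \<le> g \<alpha>}
        \<le> measure (vacant_law P u) ({\<alpha>. s \<le> f \<alpha>} \<inter> {\<alpha>. t \<le> g \<alpha>})"
      using assms(5,8) by (intro vacant_law_up_sets_correlated level assms(4,7))
        (auto dest: monoD intro: order_trans)
    then show "measure (vacant_law P u) {\<alpha> \<in> space (vacant_law P u). s \<le> f \<alpha>} *
        measure (vacant_law P u) {\<alpha> \<in> space (vacant_law P u). t \<le> g \<alpha>}
        \<le> measure (vacant_law P u) {\<alpha> \<in> space (vacant_law P u). s \<le> f \<alpha> \<and> t \<le> g \<alpha>}"
      by (simp add: space_Q Collect_conj_eq)
  qed
qed

end
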